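(* Let $\lambda>-1$ and $t\in\mathbb{R}$, and let $\{P_n(x;t,\lambda)\}_{n=0}^\infty$ be the sequence of monic generalised Airy polynomials, orthogonal with respect to $\omega(x;t,\lambda)=x^{\lambda}\exp(-\tfrac13x^3+tx)$ on $(0,\infty)$. For each $n=2,3,\dots$, the largest zero $x_{1,n}$ and the smallest zero $x_{n,n}$ of $P_n(x;t,\lambda)$ satisfy $$0<x_{n,n}<\alpha_{n-1}+\frac{d_n\beta_{n-1}}{e_n}<x_{1,n},$$ where $\alpha_n=\alpha_n(t;\lambda)$ and $\beta_n=\beta_n(t;\lambda)$ are the three-term recurrence coefficients of $\{P_n(x;t,\lambda)\}$ and $$d_n=\frac{P_n(0;t,\lambda)}{P_{n-1}(0;t,\lambda)}+\frac{P_{n-1}(0;t,\lambda+1)}{P_{n-2}(0;t,\lambda+1)},\qquad e_n=\frac{P_{n-1}(0;t,\lambda+1)}{P_{n-2}(0;t,\lambda+1)}\,\frac{P_{n-1}(0;t,\lambda)}{P_{n-2}(0;t,\lambda)}.$$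
   Context: For $\lambda>-1$, $t\in\mathbb{R}$, $P_n(x;t,\lambda)$ is the monic polynomial of degree $n$ with $\int_0^\infty P_m(x;t,\lambda)P_n(x;t,\lambda)\,x^{\lambda}\exp(-\tfrac13x^3+tx)\,\mathrm{d}x=0$ for $m\ne n$. The recurrence coefficients are defined by $xP_n(x;t,\lambda)=P_{n+1}(x;t,\lambda)+\alpha_n(t;\lambda)P_n(x;t,\lambda)+\beta_n(t;\lambda)P_{n-1}(x;t,\lambda)$ with $P_{-1}=0$, $P_0=1$. The zeros of $P_n(x;t,\lambda)$ are real, simple and lie in $(0,\infty)$. *)

theory Defs
  imports "HOL-Analysis.Analysis" "HOL-Computational_Algebra.Polynomial"
begin

definition airy_weight :: "real \<Rightarrow> real \<Rightarrow> real \<Rightarrow> real" where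
  "airy_weight t l x = x powr l * exp (- (x ^ 3) / 3 + t * x)"

(* Integrability is not listed as a condition: for l > -1 every polynomial times the
   weight is Lebesgue integrable on (0, infinity), so no orthogonality condition
   holds merely because the integral of a non-integrable function is 0. *)
definition monic_airy_polys :: "real \<Rightarrow> real \<Rightarrow> (nat \<Rightarrow> real poly) \<Rightarrow> bool" where
  "monic_airy_polys t l P \<longleftrightarrow>
     (\<forall>n. degree (P n) = n \<and> lead_coeff (P n) = 1) \<and>
     (\<forall>m n. m \<noteq> n \<longrightarrow>
        (LINT x:{0<..}|lborel. poly (P m) x * poly (P n) x * airy_weight t l x) = 0)"

(* The case n = 0 encodes the convention P_(-1) = 0, so b 0 is left unconstrained. *)
definition recurrence_coeffs ::
  "(nat \<Rightarrow> real poly) \<Rightarrow> (nat \<Rightarrow> real) \<Rightarrow> (nat \<Rightarrow> real) \<Rightarrow> bool" where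
  "recurrence_coeffs P a b \<longleftrightarrow>
     (\<forall>n. [:0, 1:] * P n =
        P (Suc n) + smult (a n) (P n) + smult (b n) (if n = 0 then 0 else P (n - 1)))"

definition zeros :: "real poly \<Rightarrow> real set" where
  "zeros p = {x. poly p x = 0}"

(* P and Q stand for the sequences with parameters lambda and lambda + 1. *)
definition airy_d :: "(nat \<Rightarrow> real poly) \<Rightarrow> (nat \<Rightarrow> real poly) \<Rightarrow> nat \<Rightarrow> real" where
  "airy_d P Q n =
     poly (P n) 0 / poly (P (n - 1)) 0 + poly (Q (n - 1)) 0 / poly (Q (n - 2)) 0"

definition airy_e :: "(nat \<Rightarrow> real poly) \<Rightarrow> (nat \<Rightarrow> real poly) \<Rightarrow> nat \<Rightarrow> real" where
  "airy_e P Q n =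
     poly (Q (n - 1)) 0 / poly (Q (n - 2)) 0 * (poly (P (n - 1)) 0 / poly (P (n - 2)) 0)"

end

theory Submission imports Defs
begin

text \<open>
  Write \<open>G\<close> for the number \<open>\<alpha> (n - 1) + d n * \<beta> (n - 1) / e n\<close> that is to be located
  and \<open>L p\<close> for the integral of the polynomial \<open>p\<close> against the weight with parameter \<open>\<lambda>\<close>.
  The reason for the inequalities is that \<open>G\<close> is a weighted mean, with strictly positive
  weights, of the \<open>n \<ge> 2\<close> distinct positive zeros of \<open>P n\<close>.

  To see this, note that raising the parameter \<open>\<lambda>\<close> by one multiplies the weight by \<open>x\<close>, so that
  \<open>x * Q (n - 1)\<close> is the combination of \<open>P n\<close> and \<open>P (n - 1)\<close> that vanishes at the origin
  (\<open>christoffel_shift\<close>).  The combination of \<open>Q (n - 1)\<close> and \<open>Q (n - 2)\<close> that vanishes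
  at the origin is likewise \<open>x * R\<close> for some \<open>R\<close>, of degree \<open>n - 2\<close>.  Together these give
  \<open>x^2 * R = P n - d n * P (n - 1) + e n * P (n - 2)\<close>, which is how \<open>d\<close> and \<open>e\<close> arise, and
  eliminating \<open>P (n - 2)\<close> with the three-term recurrence yields
  \<open>\<beta> (n - 1) * x^2 * R = (\<beta> (n - 1) - e n) * P n + e n * (x - G) * P (n - 1)\<close>.
  At a zero \<open>x\<close> of \<open>P n\<close> the first term on the right disappears.

  Now \<open>L (R * P (n - 1)) = 0\<close> because the degree of \<open>R\<close> is too small, and Gauss quadrature
  (\<open>gauss_quadrature\<close>) evaluates this integral at the zeros of \<open>P n\<close> with
  positive weights \<open>c x\<close>.  Since \<open>e n\<close> is nonzero, the sum of
  \<open>c x * (P (n - 1) x)^2 / x^2 * (x - G)\<close> over the zeros \<open>x\<close> of \<open>P n\<close> is therefore zero.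
  The coefficient of every \<open>x - G\<close> is positive because \<open>P n\<close> and \<open>P (n - 1)\<close> have no common
  zero (\<open>no_common_zero\<close>).  Apart from the factor \<open>x\<close> that raising \<open>\<lambda>\<close> contributes, the
  shape of the weight matters only for the convergence and the strict positivity of the integral
  (\<open>airy_functional\<close>).
\<close>

section \<open>Polynomials with prescribed simple roots\<close>

definition root_poly :: "real set \<Rightarrow> real poly" where
  "root_poly A = (\<Prod>a\<in>A. [:- a, 1:])"

lemma degree_root_poly: "degree (root_poly A) = card A"
  by (simp add: root_poly_def degree_prod_sum_eq)

lemma lead_coeff_root_poly: "lead_coeff (root_poly A) = 1"
  by (simp add: root_poly_def lead_coeff_prod)

lemma root_poly_nonzero: "root_poly A \<noteq> 0"
  using lead_coeff_root_poly[of A] by auto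

lemma poly_root_poly_eq_0_iff: "finite A \<Longrightarrow> poly (root_poly A) x = 0 \<longleftrightarrow> x \<in> A"
  by (auto simp: root_poly_def poly_prod)

lemma root_poly_dvd:
  assumes "finite A" "\<And>a. a \<in> A \<Longrightarrow> poly p a = 0"
  shows "root_poly A dvd p"
  using assms
proof (induction A arbitrary: p rule: finite_induct)
  case empty
  then show ?case by (simp add: root_poly_def)
next
  case (insert a A)
  have "poly p a = 0" using insert.prems by blast
  then obtain q where q: "p = [:- a, 1:] * q"
    unfolding poly_eq_0_iff_dvd by (elim dvdE)
  have "poly q b = 0" if "b \<in> A" for b
  proof -
    have "poly p b = 0" "b \<noteq> a" using insert.prems insert.hyps that by auto
    then show ?thesis by (simp add: q)
  qed
  then have "root_poly A dvd q" by (rule insert.IH)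
  then have "[:- a, 1:] * root_poly A dvd [:- a, 1:] * q" by (rule mult_dvd_mono[OF dvd_refl])
  then show ?case
    using insert.hyps by (simp only: q root_poly_def prod.insert not_False_eq_True)
qed

lemma lower_degree_if_leading_cancels:
  fixes q S :: "real poly"
  assumes "degree q = n" "degree S = n" "lead_coeff q = lead_coeff S"
  shows "q - S = 0 \<or> degree (q - S) < n"
proof -
  have "degree (q - S) \<le> n" using assms by (intro degree_diff_le) auto
  moreover have "coeff (q - S) n = 0" using assms by simp
  ultimately show ?thesis by (metis le_neq_implies_less leading_coeff_0_iff)
qed

lemma rootless_poly_constant_sign:
  fixes q :: "real poly"
  assumes "\<And>x. poly q x \<noteq> 0"
  shows "(\<forall>x. poly q x > 0) \<or> (\<forall>x. poly q x < 0)"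
proof (rule ccontr)
  assume "\<not> ?thesis"
  then obtain x y where xy: "\<not> poly q x > 0" "\<not> poly q y < 0" by auto
  have "poly q x < 0" "poly q y > 0"
    using xy assms[of x] assms[of y] by auto
  then have "x \<noteq> y" "poly q x * poly q y < 0" by (auto simp: mult_less_0_iff)
  then show False
    using poly_IVT[of x y q] poly_IVT[of y x q] assms
    by (metis linorder_neqE_linordered_idom mult.commute)
qed

section \<open>Orthogonal polynomials on the half line\<close>

text \<open>
  Integration against a weight on \<open>(0, \<infinity>)\<close> enters the argument only through these
  three properties, which are inherited when the weight is multiplied by \<open>x\<close>.
\<close>

locale half_line_functional =
  fixes L :: "real poly \<Rightarrow> real"
  assumes add: "L (p + q) = L p + L q"
    and smult: "L (smult c p) = c * L p"
    and pos: "p \<noteq> 0 \<Longrightarrow> (\<And>x. x > 0 \<Longrightarrow> poly p x \<ge> 0) \<Longrightarrow> L p > 0"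
begin

lemma zero [simp]: "L 0 = 0"
  using smult[of 0 0] by simp

lemma diff: "L (p - q) = L p - L q"
  using add[of p "smult (-1) q"] by (simp add: smult[of "-1" q, simplified])

lemma sum: "L (\<Sum>x\<in>A. f x) = (\<Sum>x\<in>A. L (f x))"
  by (induction A rule: infinite_finite_induct) (simp_all add: add)

lemma square_pos: "p \<noteq> 0 \<Longrightarrow> L (p * p) > 0"
  by (rule pos) auto

lemma half_line_functional_shift: "half_line_functional (\<lambda>p. L ([:0, 1:] * p))"
proof
  fix p q :: "real poly" and c :: real
  show "L ([:0, 1:] * (p + q)) = L ([:0, 1:] * p) + L ([:0, 1:] * q)"
    by (simp only: distrib_left add)
  show "L ([:0, 1:] * smult c p) = c * L ([:0, 1:] * p)"
    by (simp only: mult_smult_right smult)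
  assume "p \<noteq> 0" "\<And>x. x > 0 \<Longrightarrow> poly p x \<ge> 0"
  then show "L ([:0, 1:] * p) > 0" by (intro pos) auto
qed

end

locale orthogonal_sequence = half_line_functional +
  fixes P :: "nat \<Rightarrow> real poly"
  assumes degree: "degree (P n) = n"
    and monic: "lead_coeff (P n) = 1"
    and orthogonal: "m \<noteq> n \<Longrightarrow> L (P m * P n) = 0"
begin

lemma nonzero: "P n \<noteq> 0"
  using monic[of n] by auto

lemma orthogonal_lower_degree: "degree q < n \<Longrightarrow> L (q * P n) = 0"
proof (induction "degree q" arbitrary: q rule: less_induct)
  case less
  define c where "c = lead_coeff q"
  define r where "r = q - smult c (P (degree q))"
  have "r = 0 \<or> degree r < degree q"
  proof (cases "q = 0")
    case False
    then have "degree (smult c (P (degree q))) = degree q"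
      "lead_coeff q = lead_coeff (smult c (P (degree q)))"
      using monic[of "degree q"] by (simp_all add: c_def degree)
    then show ?thesis unfolding r_def by (intro lower_degree_if_leading_cancels) auto
  qed (simp add: r_def c_def)
  then have "L (r * P n) = 0"
    using less.hyps[of r] less.prems by (elim disjE) simp_all
  moreover have "L (P (degree q) * P n) = 0"
    using less.prems by (intro orthogonal) simp
  moreover have "q * P n = r * P n + smult c (P (degree q) * P n)"
    by (simp add: r_def algebra_simps)
  ultimately show ?case by (simp add: add smult)
qed

text \<open>
  Such a \<open>q\<close> differs from \<open>P n\<close> by a polynomial of lower degree, so the integral is that of
  \<open>P n * P n\<close>.
\<close>

lemma monic_product_pos:
  assumes "degree q = n" "lead_coeff q = 1"
  shows "L (q * P n) > 0"
proof -
  have "q - P n = 0 \<or> degree (q - P n) < n"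
    using assms by (intro lower_degree_if_leading_cancels) (use monic[of n] in \<open>simp_all add: degree\<close>)
  then have "L ((q - P n) * P n) = 0" using orthogonal_lower_degree by auto
  then have "L (q * P n) = L (P n * P n)" by (simp add: left_diff_distrib diff)
  then show ?thesis using square_pos[OF nonzero] by simp
qed

text \<open>
  If \<open>S\<close> also has the defining properties, then \<open>P n - S\<close> is orthogonal to itself.
\<close>

lemma monic_orthogonal_unique:
  assumes S: "degree S = n" "lead_coeff S = 1"
    and orth: "\<And>q. degree q < n \<Longrightarrow> L (q * S) = 0"
  shows "S = P n"
proof (rule ccontr)
  assume ne: "S \<noteq> P n"
  define D where "D = P n - S"
  have D0: "D \<noteq> 0" using ne by (simp add: D_def)
  have "D = 0 \<or> degree D < n"
    unfolding D_def 
    by (intro lower_degree_if_leading_cancels)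
      (use S monic[of n] in \<open>simp_all add: degree\<close>)
  then have "degree D < n" using D0 by simp
  then have "L (D * P n) = 0" "L (D * S) = 0"
    using orthogonal_lower_degree orth by auto
  moreover have "D * D = D * P n - D * S" by (simp add: D_def algebra_simps)
  ultimately have "L (D * D) = 0" by (simp add: diff)
  then show False using square_pos[OF D0] by simp
qed

text \<open>
  If \<open>P n = (x - a) * q\<close> with \<open>a \<le> 0\<close>, then \<open>q * P n\<close> is nonnegative on the half line, although
  orthogonality forces its integral to vanish.  The same contradiction rules out a double zero,
  this time using \<open>P n = (x - a)^2 * q\<close>.
\<close>

lemma zeros_pos:
  assumes "poly (P n) a = 0"
  shows "a > 0"
proof (rule ccontr)
  assume "\<not> a > 0"
  obtain q where q: "P n = [:- a, 1:] * q"
    using assms unfolding poly_eq_0_iff_dvd by (elim dvdE)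
  have q0: "q \<noteq> 0" using nonzero[of n] q by auto
  then have "degree (P n) = Suc (degree q)" by (subst q, subst degree_mult_eq) auto
  then have "L (q * P n) = 0" by (intro orthogonal_lower_degree) (simp add: degree)
  moreover have "L (q * P n) > 0"
  proof (rule pos)
    fix x :: real assume "x > 0"
    have "poly (q * P n) x = (x - a) * (poly q x)\<^sup>2"
      by (simp add: q power2_eq_square algebra_simps)
    then show "poly (q * P n) x \<ge> 0" using \<open>x > 0\<close> \<open>\<not> a > 0\<close> by simp
  qed (use q0 nonzero in simp)
  ultimately show False by simp
qed

lemma zeros_simple: "\<not> [:- a, 1:] * [:- a, 1:] dvd P n"
proof
  assume "[:- a, 1:] * [:- a, 1:] dvd P n"
  then obtain q where q: "P n = ([:- a, 1:] * [:- a, 1:]) * q" by (elim dvdE)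
  have q0: "q \<noteq> 0" using nonzero[of n] q by auto
  then have "degree (P n) = degree ([:- a, 1:] * [:- a, 1:]) + degree q"
    unfolding q by (intro degree_mult_eq) simp
  also have "degree ([:- a, 1:] * [:- a, 1:]) = 2" by simp
  finally have "L (q * P n) = 0" by (intro orthogonal_lower_degree) (simp add: degree)
  moreover have "L (([:- a, 1:] * q) * ([:- a, 1:] * q)) > 0"
    using q0 by (intro square_pos no_zero_divisors) simp_all
  moreover have "q * P n = ([:- a, 1:] * q) * ([:- a, 1:] * q)" by (simp only: q mult_ac)
  ultimately show False by simp
qed

lemma finite_zeros: "finite (zeros (P n))"
  unfolding zeros_def by (rule poly_roots_finite[OF nonzero])

text \<open>
  Let \<open>s\<close> be the product of \<open>x - a\<close> over the real zeros and \<open>P n = s * q\<close>.  Since the zeros are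
  simple, \<open>q\<close> has none and keeps its sign; so \<open>s * P n = s^2 * q\<close> has a nonzero integral and
  \<open>s\<close> must have degree at least \<open>n\<close>.
\<close>

lemma card_zeros: "card (zeros (P n)) = n"
proof (rule ccontr)
  define Z where "Z = zeros (P n)"
  define s where "s = root_poly Z"
  assume "card (zeros (P n)) \<noteq> n"
  moreover have "card (zeros (P n)) \<le> n"
    using card_poly_roots_bound[OF nonzero, of n] by (simp add: zeros_def degree)
  ultimately have "degree s < n" by (simp add: s_def Z_def degree_root_poly)
  then have 0: "L (s * P n) = 0" by (rule orthogonal_lower_degree)
  have s0: "s \<noteq> 0" by (simp add: s_def root_poly_nonzero)
  have "s dvd P n" unfolding s_def
    by (rule root_poly_dvd) (auto simp: Z_def finite_zeros, simp add: zeros_def)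
  then obtain q where q: "P n = s * q" by (elim dvdE)
  have q0: "q \<noteq> 0" using nonzero[of n] q by auto
  have "poly q a \<noteq> 0" for a
  proof
    assume qa: "poly q a = 0"
    then have "a \<in> Z" by (simp add: Z_def zeros_def q)
    then have "poly s a = 0" by (simp add: s_def poly_root_poly_eq_0_iff Z_def finite_zeros)
    with qa have "[:- a, 1:] * [:- a, 1:] dvd s * q"
      unfolding poly_eq_0_iff_dvd by (intro mult_dvd_mono)
    then show False using zeros_simple[of a n] q by simp
  qed
  then consider "\<forall>x. poly q x > 0" | "\<forall>x. poly q x < 0"
    using rootless_poly_constant_sign by blast
  then show False
  proof cases
    case 1
    have "poly (s * P n) x \<ge> 0" for x
    proof -
      have "poly (s * P n) x = (poly s x)\<^sup>2 * poly q x"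
        by (simp add: q power2_eq_square)
      then show ?thesis using 1 by (simp add: less_imp_le)
    qed
    then have "L (s * P n) > 0" using s0 nonzero by (intro pos) auto
    with 0 show False by simp
  next
    case 2
    have "poly (smult (-1) (s * P n)) x \<ge> 0" for x
    proof -
      have "poly (smult (-1) (s * P n)) x = (poly s x)\<^sup>2 * (- poly q x)"
        by (simp add: q power2_eq_square)
      also have "\<dots> \<ge> 0" using 2 by (intro mult_nonneg_nonneg) (auto simp: less_imp_le)
      finally show ?thesis .
    qed
    then have "L (smult (-1) (s * P n)) > 0" using s0 nonzero by (intro pos) auto
    with 0 show False unfolding smult by simp
  qed
qed

lemma poly_0_nonzero: "poly (P n) 0 \<noteq> 0"
  using zeros_pos[of n 0] by auto

text \<open>
  A common zero \<open>a\<close> gives \<open>P (Suc n) = (x - a) * q\<close> and \<open>P n = (x - a) * r\<close>, so that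
  \<open>q * P n = r * P (Suc n)\<close>.  The right-hand side has integral zero, whereas the
  left-hand side has a positive one because \<open>q\<close> is monic of degree \<open>n\<close>.
\<close>

lemma no_common_zero:
  assumes "poly (P (Suc n)) a = 0"
  shows "poly (P n) a \<noteq> 0"
proof
  assume "poly (P n) a = 0"
  then obtain r where r: "P n = [:- a, 1:] * r"
    unfolding poly_eq_0_iff_dvd by (elim dvdE)
  obtain q where q: "P (Suc n) = [:- a, 1:] * q"
    using assms unfolding poly_eq_0_iff_dvd by (elim dvdE)
  have r0: "r \<noteq> 0" and q0: "q \<noteq> 0" using nonzero[of n] nonzero[of "Suc n"] r q by auto
  have "degree (P n) = Suc (degree r)" by (subst r, subst degree_mult_eq) (use r0 in auto)
  then have "L (r * P (Suc n)) = 0"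
    by (intro orthogonal_lower_degree) (simp add: degree)
  moreover have "r * P (Suc n) = q * P n" by (simp only: q r mult_ac)
  ultimately have qP: "L (q * P n) = 0" by simp
  have "degree (P (Suc n)) = Suc (degree q)" by (subst q, subst degree_mult_eq) (use q0 in auto)
  then have dq: "degree q = n" by (simp add: degree)
  have lq: "lead_coeff q = 1"
    using monic[of "Suc n"] unfolding q lead_coeff_mult by simp
  show False using qP monic_product_pos[OF dq lq] by simp
qed

text \<open>
  With the Lagrange polynomials \<open>l x\<close> at the zeros of \<open>P n\<close> (value one at \<open>x\<close>, zero at the
  other zeros), \<open>f\<close> agrees on all zeros with the sum of \<open>f(x) * (l x)^2\<close>.  The difference is
  a multiple of \<open>P n\<close> of degree below \<open>2 * n\<close>, hence has integral zero.  Interpolating with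
  the squares makes it plain that the weights are positive.
\<close>

lemma gauss_quadrature:
  obtains c where "\<And>x. x \<in> zeros (P n) \<Longrightarrow> c x > 0"
    and "\<And>f. degree f < 2 * n \<Longrightarrow> L f = (\<Sum>x\<in>zeros (P n). c x * poly f x)"
proof -
  define Z where "Z = zeros (P n)"
  have fin: "finite Z" and card: "card Z = n" by (simp_all add: Z_def finite_zeros card_zeros)
  define l where
    "l = (\<lambda>x. smult (inverse (poly (root_poly (Z - {x})) x)) (root_poly (Z - {x})))"
  have l_value: "poly (l x) y = (if y = x then 1 else 0)" if "x \<in> Z" "y \<in> Z" for x y
    using that fin poly_root_poly_eq_0_iff[of "Z - {x}"] by (auto simp: l_def)
  have l_degree: "degree (l x) \<le> n - 1" if "x \<in> Z" for x
    using that fin card unfolding l_def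
    by (intro order_trans[OF degree_smult_le]) (simp add: degree_root_poly)
  define c where "c = (\<lambda>x. L (l x * l x))"
  have "c x > 0" if "x \<in> Z" for x
    unfolding c_def using l_value[OF that that] by (intro square_pos) auto
  moreover have "L f = (\<Sum>x\<in>Z. c x * poly f x)" if f: "degree f < 2 * n" for f
  proof -
    define r where "r = (\<Sum>x\<in>Z. smult (poly f x) (l x * l x))"
    have "degree (l x * l x) \<le> 2 * n - 1" if "x \<in> Z" for x
      using degree_mult_le[of "l x" "l x"] l_degree[OF that] f by linarith
    then have "degree r \<le> 2 * n - 1" unfolding r_def
      by (intro degree_sum_le[OF fin]) (auto intro: order_trans[OF degree_smult_le])
    then have deg: "degree (f - r) < 2 * n"
      using f by (intro degree_diff_less) auto
    have "poly r y = poly f y" if "y \<in> Z" for y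
    proof -
      have "poly r y = (\<Sum>x\<in>Z. if x = y then poly f y else 0)"
        unfolding r_def poly_sum by (rule sum.cong) (auto simp: l_value that)
      then show ?thesis using that fin by simp
    qed
    then have "root_poly Z dvd f - r" by (intro root_poly_dvd fin) simp
    moreover have "P n = root_poly Z"
    proof (rule poly_eqI_degree_lead_coeff[where n = n and A = Z])
      show "coeff (P n) n = coeff (root_poly Z) n"
        using monic[of n] lead_coeff_root_poly[of Z] by (simp add: degree degree_root_poly card)
      show "poly (P n) z = poly (root_poly Z) z" if "z \<in> Z" for z
        using that poly_root_poly_eq_0_iff[OF fin, of z] by (simp add: Z_def zeros_def)
    qed (auto simp: card degree degree_root_poly)
    ultimately obtain q where q: "f - r = P n * q" by (metis dvdE)
    have "L (f - r) = 0"
    proof (cases "q = 0")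
      case True
      then show ?thesis by (simp add: q)
    next
      case False
      then have "degree (f - r) = n + degree q"
        unfolding q by (subst degree_mult_eq) (use nonzero in \<open>auto simp: degree\<close>)
      then have "L (q * P n) = 0" using deg by (intro orthogonal_lower_degree) simp
      then show ?thesis by (simp add: q mult.commute)
    qed
    then have "L f = L r" by (simp add: diff)
    also have "L r = (\<Sum>x\<in>Z. c x * poly f x)"
      unfolding r_def sum smult c_def by (simp add: mult.commute)
    finally show ?thesis .
  qed
  ultimately show ?thesis using that[of c] unfolding Z_def by blast
qed

text \<open>
  The right-hand side vanishes at the origin and is orthogonal to all polynomials of degree
  below \<open>n\<close>.  Dividing it by \<open>x\<close> thus leaves a monic polynomial that is orthogonal with respect to
  the shifted functional, and there is only one.
\<close>

lemma christoffel_shift: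
  assumes "orthogonal_sequence (\<lambda>p. L ([:0, 1:] * p)) Q"
  shows "[:0, 1:] * Q n = P (Suc n) - smult (poly (P (Suc n)) 0 / poly (P n) 0) (P n)"
proof -
  interpret Q: orthogonal_sequence "\<lambda>p. L ([:0, 1:] * p)" Q by (fact assms)
  define A where "A = poly (P (Suc n)) 0 / poly (P n) 0"
  define W where "W = P (Suc n) - smult A (P n)"
  have "poly W 0 = 0" using poly_0_nonzero[of n] by (simp add: W_def A_def)
  then have "[:0, 1:] dvd W" using poly_eq_0_iff_dvd[of W 0] by simp
  then obtain S where S: "W = [:0, 1:] * S" by (elim dvdE)
  have cW: "coeff W (Suc n) = 1"
    using monic[of "Suc n"] coeff_eq_0[of "P n" "Suc n"] by (simp add: W_def degree)
  have dW_le: "degree W \<le> Suc n" unfolding W_def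
    by (intro degree_diff_le) (auto intro: order_trans[OF degree_smult_le] simp: degree)
  have W0: "W \<noteq> 0" using cW by auto
  have dW: "degree W = Suc n" using cW dW_le le_degree[of W "Suc n"] by simp
  have "degree W = Suc (degree S)"
    using W0 unfolding S by (subst degree_mult_eq) auto
  with dW have dS: "degree S = n" by simp
  have lS: "lead_coeff S = 1" using cW unfolding dW[symmetric] S lead_coeff_mult by simp
  have "S = Q n"
  proof (rule Q.monic_orthogonal_unique[OF dS lS])
    fix q :: "real poly" assume q: "degree q < n"
    have "[:0, 1:] * (q * S) = q * P (Suc n) - smult A (q * P n)"
      using S by (simp add: W_def algebra_simps)
    then show "L ([:0, 1:] * (q * S)) = 0"
      using q by (simp only: diff smult orthogonal_lower_degree less_SucI)
  qed
  then show ?thesis using S by (simp add: W_def A_def)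
qed

section \<open>The separating point as a weighted mean of the zeros\<close>

lemma mean_strictly_between:
  fixes w :: "real \<Rightarrow> real"
  assumes fin: "finite Z" and card: "card Z \<ge> 2"
    and w: "\<And>x. x \<in> Z \<Longrightarrow> w x > 0"
    and mean: "(\<Sum>x\<in>Z. w x * (x - G)) = 0"
  shows "Min Z < G \<and> G < Max Z"
proof -
  have ne: "Z \<noteq> {}" using card by auto
  have lt: "Min Z < Max Z"
  proof (rule ccontr)
    assume "\<not> Min Z < Max Z"
    then have "x = Min Z" if "x \<in> Z" for x
      using Min_le[OF fin that] Max_ge[OF fin that] by linarith
    then have "Z \<subseteq> {Min Z}" by auto
    then have "card Z \<le> 1" using card_mono[of "{Min Z}" Z] by simp
    then show False using card by simp
  qed
  have "Min Z < G"
  proof (rule ccontr)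
    assume G: "\<not> Min Z < G"
    have "(\<Sum>x\<in>Z. w x * (x - G)) > 0"
    proof (rule sum_pos2[OF fin Max_in[OF fin ne]])
      show "0 < w (Max Z) * (Max Z - G)"
        using G lt w[OF Max_in[OF fin ne]] by (intro mult_pos_pos) auto
      show "0 \<le> w x * (x - G)" if "x \<in> Z" for x
        using G w[OF that] Min_le[OF fin that] by (intro mult_nonneg_nonneg) auto
    qed
    with mean show False by simp
  qed
  moreover have "G < Max Z"
  proof (rule ccontr)
    assume G: "\<not> G < Max Z"
    have "(\<Sum>x\<in>Z. w x * (G - x)) > 0"
    proof (rule sum_pos2[OF fin Min_in[OF fin ne]])
      show "0 < w (Min Z) * (G - Min Z)"
        using G lt w[OF Min_in[OF fin ne]] by (intro mult_pos_pos) auto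
      show "0 \<le> w x * (G - x)" if "x \<in> Z" for x
        using G w[OF that] Max_ge[OF fin that] by (intro mult_nonneg_nonneg) auto
    qed
    moreover have "(\<Sum>x\<in>Z. w x * (G - x)) = - (\<Sum>x\<in>Z. w x * (x - G))"
      unfolding sum_negf[symmetric] by (intro sum.cong) (auto simp: algebra_simps)
    ultimately show False using mean by simp
  qed
  ultimately show ?thesis ..
qed

theorem separating_point_between_zeros:
  assumes Q: "orthogonal_sequence (\<lambda>p. L ([:0, 1:] * p)) Q"
    and rec: "[:0, 1:] * P (Suc m) = P (Suc (Suc m)) + smult a (P (Suc m)) + smult b (P m)"
    and d: "d = poly (P (Suc (Suc m))) 0 / poly (P (Suc m)) 0
              + poly (Q (Suc m)) 0 / poly (Q m) 0"
    and e: "e = poly (Q (Suc m)) 0 / poly (Q m) 0 * (poly (P (Suc m)) 0 / poly (P m) 0)"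
    and G: "G = a + d * b / e"
  shows "Min (zeros (P (Suc (Suc m)))) < G \<and> G < Max (zeros (P (Suc (Suc m))))"
proof -
  interpret Q: orthogonal_sequence "\<lambda>p. L ([:0, 1:] * p)" Q by (fact Q)
  let ?n = "Suc (Suc m)"
  let ?Z = "zeros (P ?n)"
  define B where "B = poly (Q (Suc m)) 0 / poly (Q m) 0"
  have e0: "e \<noteq> 0"
    unfolding e using poly_0_nonzero Q.poly_0_nonzero by simp
  have "poly (Q (Suc m) - smult B (Q m)) 0 = 0"
    using Q.poly_0_nonzero[of m] by (simp add: B_def)
  then have "[:0, 1:] dvd Q (Suc m) - smult B (Q m)"
    by (simp only: poly_eq_0_iff_dvd minus_zero)
  then obtain R where R: "Q (Suc m) - smult B (Q m) = [:0, 1:] * R" by (elim dvdE)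
  have R_degree: "degree R \<le> m"
  proof (cases "R = 0")
    case False
    have "degree ([:0, 1:] * R) \<le> Suc m" unfolding R[symmetric]
      by (intro degree_diff_le) (auto intro: order_trans[OF degree_smult_le] simp: Q.degree)
    moreover have "degree ([:0, 1:] * R) = Suc (degree R)"
      using False by (subst degree_mult_eq) auto
    ultimately show ?thesis by simp
  qed simp
  have R_combination: "x\<^sup>2 * poly R x
      = poly (P ?n) x - d * poly (P (Suc m)) x + e * poly (P m) x" for x
  proof -
    have Q_value: "x * poly (Q k) x
        = poly (P (Suc k)) x - poly (P (Suc k)) 0 / poly (P k) 0 * poly (P k) x" for k
      using arg_cong[OF christoffel_shift[OF Q, of k], of "\<lambda>p. poly p x"] by simp
    have xR: "x * poly R x = poly (Q (Suc m)) x - B * poly (Q m) x"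
      using arg_cong[OF R, of "\<lambda>p. poly p x"] by simp
    have "x\<^sup>2 * poly R x = x * (x * poly R x)" by (simp add: power2_eq_square)
    then have "x\<^sup>2 * poly R x = x * poly (Q (Suc m)) x - B * (x * poly (Q m) x)"
      unfolding xR by (simp add: algebra_simps)
    then show ?thesis
      unfolding Q_value d e B_def[symmetric] by (simp add: algebra_simps)
  qed
  have R_at_zero: "b * (x\<^sup>2 * poly R x) = e * ((x - G) * poly (P (Suc m)) x)"
    if "poly (P ?n) x = 0" for x
  proof -
    have bP: "b * poly (P m) x = (x - a) * poly (P (Suc m)) x"
      using arg_cong[OF rec, of "\<lambda>p. poly p x"] that by (simp add: algebra_simps)
    have "b * (x\<^sup>2 * poly R x) = e * (b * poly (P m) x) - b * d * poly (P (Suc m)) x"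
      unfolding R_combination using that by (simp add: algebra_simps)
    also have "\<dots> = (e * (x - a) - b * d) * poly (P (Suc m)) x"
      unfolding bP by (simp add: algebra_simps)
    also have "e * (x - a) - b * d = e * (x - G)"
      using e0 by (simp add: G field_simps)
    finally show ?thesis by simp
  qed
  obtain c where c: "\<And>x. x \<in> ?Z \<Longrightarrow> c x > 0"
    and gauss: "\<And>f. degree f < 2 * ?n \<Longrightarrow> L f = (\<Sum>x\<in>?Z. c x * poly f x)"
    using gauss_quadrature[of ?n] by blast
  define w where "w = (\<lambda>x. c x * (poly (P (Suc m)) x)\<^sup>2 / x\<^sup>2)"
  have "w x > 0" if "x \<in> ?Z" for x
    using that c[OF that] no_common_zero[of "Suc m" x] zeros_pos[of ?n x]
    by (simp add: w_def zeros_def)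
  moreover have "(\<Sum>x\<in>?Z. w x * (x - G)) = 0"
  proof -
    have "degree (R * P (Suc m)) < 2 * ?n"
      using degree_mult_le[of R "P (Suc m)"] R_degree by (simp add: degree)
    then have "(\<Sum>x\<in>?Z. c x * poly (R * P (Suc m)) x) = L (R * P (Suc m))"
      using gauss by simp
    also have "\<dots> = 0" using R_degree by (intro orthogonal_lower_degree) simp
    finally have "0 = b * (\<Sum>x\<in>?Z. c x * poly (R * P (Suc m)) x)" by simp
    also have "\<dots> = (\<Sum>x\<in>?Z. e * (w x * (x - G)))"
      unfolding sum_distrib_left
    proof (rule sum.cong)
      fix x assume "x \<in> ?Z"
      then have zero: "poly (P ?n) x = 0" by (simp add: zeros_def)
      then have "x \<noteq> 0" using zeros_pos[of ?n x] by simp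
      then have "b * (c x * poly (R * P (Suc m)) x)
          = c x * poly (P (Suc m)) x * (b * (x\<^sup>2 * poly R x)) / x\<^sup>2"
        by (simp add: field_simps)
      also have "\<dots> = e * (w x * (x - G))"
        unfolding R_at_zero[OF zero] w_def by (simp add: power2_eq_square)
      finally show "b * (c x * poly (R * P (Suc m)) x) = e * (w x * (x - G))" .
    qed simp
    also have "\<dots> = e * (\<Sum>x\<in>?Z. w x * (x - G))" by (simp add: sum_distrib_left)
    finally show ?thesis using e0 by simp
  qed
  ultimately show ?thesis
    by (intro mean_strictly_between[where w = w]) (auto simp: finite_zeros card_zeros)
qed

end

section \<open>Integration against the Airy weight\<close>

text \<open>
  The cubic term beats the linear one, so \<open>exp (- x^3 / 3 + t * x)\<close> is dominated by a
  multiple of \<open>exp (- x)\<close> and the integral by a Gamma integral.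
\<close>

lemma cubic_exponent_bound:
  fixes t x :: real
  assumes "x > 0"
  shows "- (x ^ 3) / 3 + t * x \<le> 3 * (\<bar>t + 1\<bar> + 1)\<^sup>2 - x"
proof -
  define u where "u = \<bar>t + 1\<bar> + 1"
  have u: "u \<ge> 1" "t + 1 \<le> u" by (auto simp: u_def)
  have "(t + 1) * x \<le> u * x" using u assms by (intro mult_right_mono) auto
  moreover have "u * x \<le> 3 * u\<^sup>2 + x ^ 3 / 3"
  proof (cases "x \<le> 3 * u")
    case True
    then have "u * x \<le> u * (3 * u)" using u by (intro mult_left_mono) auto
    then show ?thesis using assms by (simp add: power2_eq_square add_increasing2)
  next
    case False
    have "3 * u \<le> x * x"
      using mult_mono[of "3 * u" x 1 x] False u by simp
    then have "(3 * u) * x \<le> (x * x) * x" using assms by (intro mult_right_mono) auto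
    moreover have "(x * x) * x = x ^ 3" by (simp add: power3_eq_cube)
    moreover have "0 \<le> 3 * u\<^sup>2" by simp
    ultimately show ?thesis by linarith
  qed
  ultimately show ?thesis unfolding u_def[symmetric] by (simp add: algebra_simps)
qed

lemma airy_weight_measurable [measurable]: "airy_weight t l \<in> borel_measurable borel"
  unfolding airy_weight_def by measurable

lemma poly_measurable [measurable]: "poly (p :: real poly) \<in> borel_measurable borel"
  by (intro borel_measurable_continuous_onI continuous_intros)

lemma set_integrable_power_airy_weight:
  assumes "l > -1"
  shows "set_integrable lborel {0<..} (\<lambda>x. x ^ k * airy_weight t l x)"
proof -
  define s where "s = real k + l + 1"
  define C where "C = exp (3 * (\<bar>t + 1\<bar> + 1)\<^sup>2)"
  have s: "s > 0" using assms by (simp add: s_def)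
  have "(\<lambda>x. x powr (s - 1) / exp x) integrable_on {0..}"
    using Gamma_integral_real[OF s] by blast
  then have "(\<lambda>x. x powr (s - 1) / exp x) absolutely_integrable_on {0..}"
    by (rule nonnegative_absolutely_integrable_1) simp
  then have "set_integrable lebesgue {0<..} (\<lambda>x. x powr (s - 1) / exp x)"
    by (rule set_integrable_subset) auto
  then have "set_integrable lborel {0<..} (\<lambda>x. x powr (s - 1) / exp x)"
    unfolding set_integrable_def by (subst (asm) integrable_completion) simp_all
  then have "set_integrable lborel {0<..} (\<lambda>x. C * (x powr (s - 1) / exp x))"
    by (rule set_integrable_mult_right)
  then show ?thesis
  proof (rule set_integrable_bound)
    show "set_borel_measurable lborel {0<..} (\<lambda>x. x ^ k * airy_weight t l x)"
      unfolding set_borel_measurable_def by measurable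
    have "norm (x ^ k * airy_weight t l x) \<le> norm (C * (x powr (s - 1) / exp x))"
      if "x > 0" for x
    proof -
      have "exp (- (x ^ 3) / 3 + t * x) \<le> C / exp x"
        using cubic_exponent_bound[OF that, of t] by (simp add: C_def exp_diff[symmetric])
      then have "x powr (s - 1) * exp (- (x ^ 3) / 3 + t * x) \<le> x powr (s - 1) * (C / exp x)"
        by (intro mult_left_mono) auto
      moreover have "x ^ k * airy_weight t l x = x powr (s - 1) * exp (- (x ^ 3) / 3 + t * x)"
        using that by (simp add: airy_weight_def s_def powr_add powr_realpow)
      ultimately show ?thesis by (simp add: C_def mult.commute)
    qed
    then show "AE x in lborel. x \<in> {0<..} \<longrightarrow>
        norm (x ^ k * airy_weight t l x) \<le> norm (C * (x powr (s - 1) / exp x))"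
      by simp
  qed
qed

lemma set_integrable_poly_airy_weight:
  assumes "l > -1"
  shows "set_integrable lborel {0<..} (\<lambda>x. poly p x * airy_weight t l x)"
proof -
  have "set_integrable lborel {0<..}
      (\<lambda>x. \<Sum>k\<le>degree p. coeff p k * (x ^ k * airy_weight t l x))"
    unfolding set_integrable_def scaleR_sum_right
    by (intro Bochner_Integration.integrable_sum)
      (use set_integrable_mult_right[OF set_integrable_power_airy_weight[OF assms]]
        in \<open>simp add: set_integrable_def\<close>)
  then show ?thesis by (simp add: poly_altdef sum_distrib_right mult.assoc)
qed

definition airy_integral :: "real \<Rightarrow> real \<Rightarrow> real poly \<Rightarrow> real" where
  "airy_integral t l p = (LINT x:{0<..}|lborel. poly p x * airy_weight t l x)"

text \<open>
  Strict positivity holds because a nonzero polynomial vanishes only on a finite set, so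
  an integral of zero would make the interval \<open>(0, 1)\<close> a null set.
\<close>

lemma airy_functional:
  assumes l: "l > -1"
  shows "half_line_functional (airy_integral t l)"
proof
  fix p q :: "real poly" and c :: real
  note int = set_integrable_poly_airy_weight[OF l]
  show "airy_integral t l (p + q) = airy_integral t l p + airy_integral t l q"
    unfolding airy_integral_def by (simp add: distrib_right set_integral_add int)
  show "airy_integral t l (smult c p) = c * airy_integral t l p"
    unfolding airy_integral_def by (simp add: mult.assoc)
  assume p: "p \<noteq> 0" and nonneg: "\<And>x. x > 0 \<Longrightarrow> poly p x \<ge> 0"
  define f where "f = (\<lambda>x. indicator {0<..} x *\<^sub>R (poly p x * airy_weight t l x))"
  have f_int: "integrable lborel f"
    using int[of p t] unfolding set_integrable_def f_def .
  have f_nonneg: "f x \<ge> 0" for x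
    using nonneg[of x] by (simp add: f_def airy_weight_def indicator_def)
  have eq: "airy_integral t l p = integral\<^sup>L lborel f"
    by (simp add: airy_integral_def set_lebesgue_integral_def f_def)
  have "integral\<^sup>L lborel f \<noteq> 0"
  proof
    assume "integral\<^sup>L lborel f = 0"
    then have "AE x in lborel. f x = 0"
      using integral_nonneg_eq_0_iff_AE[OF f_int] f_nonneg by simp
    moreover have "AE x in lborel. x \<notin> {x. poly p x = 0}"
      by (intro AE_not_in finite_imp_null_set_lborel poly_roots_finite p)
    ultimately have "AE x in lborel. x \<notin> {0<..<1::real}"
    proof eventually_elim
      case (elim x)
      then show ?case by (auto simp: f_def airy_weight_def)
    qed
    then have "{0<..<1::real} \<in> null_sets lborel"
      by (subst AE_iff_null_sets) auto
    then show False by (simp add: null_sets_def)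
  qed
  moreover have "integral\<^sup>L lborel f \<ge> 0" by (intro integral_nonneg_AE) (simp add: f_nonneg)
  ultimately show "airy_integral t l p > 0" unfolding eq by simp
qed

lemma airy_integral_shift: "airy_integral t (l + 1) p = airy_integral t l ([:0, 1:] * p)"
  unfolding airy_integral_def
  by (intro set_lebesgue_integral_cong) (auto simp: airy_weight_def powr_add)

lemma monic_airy_polys_orthogonal_sequence:
  assumes "l > -1" "monic_airy_polys t l P"
  shows "orthogonal_sequence (airy_integral t l) P"
proof -
  interpret half_line_functional "airy_integral t l" by (rule airy_functional[OF assms(1)])
  show ?thesis
  proof
    show "degree (P n) = n" "lead_coeff (P n) = 1" for n
      using assms(2) unfolding monic_airy_polys_def by blast+
    show "airy_integral t l (P m * P n) = 0" if "m \<noteq> n" for m n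
      using assms(2) that unfolding monic_airy_polys_def airy_integral_def poly_mult by blast
  qed
qed

theorem theorem3p9:
  fixes t l :: real
    and P Q :: "nat \<Rightarrow> real poly"
    and \<alpha> \<beta> :: "nat \<Rightarrow> real"
    and n :: nat
  assumes "l > -1"
    and "monic_airy_polys t l P"
    and "monic_airy_polys t (l + 1) Q"
    and "recurrence_coeffs P \<alpha> \<beta>"
    and "n \<ge> 2"
  shows "0 < Min (zeros (P n))
       \<and> Min (zeros (P n)) < \<alpha> (n - 1) + airy_d P Q n * \<beta> (n - 1) / airy_e P Q n
       \<and> \<alpha> (n - 1) + airy_d P Q n * \<beta> (n - 1) / airy_e P Q n < Max (zeros (P n))"
proof -
  interpret P: orthogonal_sequence "airy_integral t l" P
    using assms by (intro monic_airy_polys_orthogonal_sequence)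
  have "orthogonal_sequence (airy_integral t (l + 1)) Q"
    using assms by (intro monic_airy_polys_orthogonal_sequence) auto
  then have Q: "orthogonal_sequence (\<lambda>p. airy_integral t l ([:0, 1:] * p)) Q"
    by (simp add: airy_integral_shift[abs_def])
  obtain m where n: "n = Suc (Suc m)"
    using assms(5) by (metis add_2_eq_Suc le_Suc_ex)
  have n1: "n - 1 = Suc m" and n2: "n - 2 = m" by (simp_all add: n)
  have rec: "[:0, 1:] * P (Suc m)
      = P (Suc (Suc m)) + smult (\<alpha> (Suc m)) (P (Suc m)) + smult (\<beta> (Suc m)) (P m)"
    using assms(4)[unfolded recurrence_coeffs_def, rule_format, of "Suc m"] by simp
  have "Min (zeros (P n)) < \<alpha> (n - 1) + airy_d P Q n * \<beta> (n - 1) / airy_e P Q n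
      \<and> \<alpha> (n - 1) + airy_d P Q n * \<beta> (n - 1) / airy_e P Q n < Max (zeros (P n))"
    unfolding airy_d_def airy_e_def n1 n2 unfolding n
    by (rule P.separating_point_between_zeros[OF Q rec refl refl refl])
  moreover have "0 < Min (zeros (P n))"
  proof -
    have "zeros (P n) \<noteq> {}" using P.card_zeros[of n] assms(5) by auto
    then have "Min (zeros (P n)) \<in> zeros (P n)" by (intro Min_in P.finite_zeros)
    then show ?thesis using P.zeros_pos by (simp add: zeros_def)
  qed
  ultimately show ?thesis by blast
qed

end
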